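(* Let $\mathcal{G}$ be a geometric algebra, and let $A_r$ and $B_s$ be a nonzero $r$-blade and a nonzero $s$-blade in $\mathcal{G}$, where $r,s\ge 1$. (a) $A_r\wedge B_s=0$ if and only if the subspaces represented by $A_r$ and $B_s$ share a nonzero vector. (b) If $A_r\wedge B_s$ is nonzero, it represents the direct sum of the subspaces represented by $A_r$ and $B_s$.
   Context: A geometric algebra $\mathcal{G}$ is a ring with unit containing a field $\mathcal{G}_0$ of characteristic zero (the scalars, with $0,1\in\mathcal{G}_0$) and a subset $\mathcal{G}_1$ (the vectors) closed under addition with $\lambda v=v\lambda\in\mathcal{G}_1$ for all $\lambda\in\mathcal{G}_0$, $v\in\mathcal{G}_1$ (so $\mathcal{G}_1$ is a $\mathcal{G}_0$-vector space), such that: the square of every vector is a scalar; the symmetric bilinear inner product of vectors $\frac12(uv+vu)\in\mathcal{G}_0$ is nondegenerate (the only vector orthogonal to all vectors is $0$); and $\mathcal{G}$ is the direct sum of the subspaces $\mathcal{G}_r$, $r\ge 0$, defined as follows. Vectors $u,v$ are orthogonal if $\frac12(uv+vu)=0$. For $r\ge 2$ an $r$-blade is a product of $r$ pairwise orthogonal vectors; $0$-blades are the scalars and $1$-blades the vectors. An $r$-vector is a finite sum of $r$-blades, and $\mathcal{G}_r$ is the set of $r$-vectors. $\langle A\rangle_r$ denotes the component of $A\in\mathcal{G}$ in $\mathcal{G}_r$. For $A=\sum_rA_r$ and $B=\sum_sB_s$ with $A_r\in\mathcal{G}_r$, $B_s\in\mathcal{G}_s$, the outer product is $A\wedge B:=\sum_{r,s}\langle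 A_rB_s\rangle_{r+s}$; it is associative. A nonzero $r$-blade $A_r$ with $r\ge 1$ represents the $r$-dimensional subspace $\{a\in\mathcal{G}_1: a\wedge A_r=0\}$, which is the span of the vectors in any expression of $A_r$ as an outer product of $r$ vectors. *)

theory Defs
  imports Main
begin

text \<open>The ambient ring is a type of class \<open>ring_1\<close>; the scalars \<open>G0\<close> and the vectors \<open>G1\<close>
  are subsets of it.\<close>

text \<open>The inverse of 2 is taken in the scalar field, since the ring itself has no division.\<close>

definition half :: "'a::ring_1 set \<Rightarrow> 'a" where
  "half G0 = (THE h. h \<in> G0 \<and> 2 * h = 1)"

definition vec_inner :: "'a::ring_1 set \<Rightarrow> 'a \<Rightarrow> 'a \<Rightarrow> 'a" where
  "vec_inner G0 u v = half G0 * (u * v + v * u)"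

definition orthogonal_vecs :: "'a::ring_1 set \<Rightarrow> 'a \<Rightarrow> 'a \<Rightarrow> bool" where
  "orthogonal_vecs G0 u v \<longleftrightarrow> vec_inner G0 u v = 0"

text \<open>The factors of a blade are orthogonal at distinct positions of the list; as orthogonality
  is symmetric, \<open>sorted_wrt\<close> expresses this. For \<open>r = 1\<close> the condition is
  vacuous and the 1-blades are exactly the elements of \<open>G1\<close>.\<close>

definition is_blade :: "'a::ring_1 set \<Rightarrow> 'a set \<Rightarrow> nat \<Rightarrow> 'a \<Rightarrow> bool" where
  "is_blade G0 G1 r A \<longleftrightarrow>
    (if r = 0 then A \<in> G0
     else \<exists>vs. length vs = r \<and> set vs \<subseteq> G1 \<and> sorted_wrt (orthogonal_vecs G0) vs
                \<and> A = prod_list vs)"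

definition multivectors :: "'a::ring_1 set \<Rightarrow> 'a set \<Rightarrow> nat \<Rightarrow> 'a set" where
  "multivectors G0 G1 r = {sum_list As |As. \<forall>A\<in>set As. is_blade G0 G1 r A}"

definition grade_decomposition ::
    "'a::ring_1 set \<Rightarrow> 'a set \<Rightarrow> 'a \<Rightarrow> (nat \<Rightarrow> 'a) \<Rightarrow> bool" where
  "grade_decomposition G0 G1 A f \<longleftrightarrow>
    (\<forall>r. f r \<in> multivectors G0 G1 r) \<and> finite {r. f r \<noteq> 0} \<and> A = (\<Sum>r | f r \<noteq> 0. f r)"

locale geometric_algebra =
  fixes G0 G1 :: "'a::ring_1 set"
  assumes scalar_zero: "0 \<in> G0"
    and scalar_one: "1 \<in> G0"
    and scalar_add: "\<lbrakk>x \<in> G0; y \<in> G0\<rbrakk> \<Longrightarrow> x + y \<in> G0"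
    and scalar_uminus: "x \<in> G0 \<Longrightarrow> - x \<in> G0"
    and scalar_mult: "\<lbrakk>x \<in> G0; y \<in> G0\<rbrakk> \<Longrightarrow> x * y \<in> G0"
    and scalar_commute: "\<lbrakk>x \<in> G0; y \<in> G0\<rbrakk> \<Longrightarrow> x * y = y * x"
    and scalar_inverse: "\<lbrakk>x \<in> G0; x \<noteq> 0\<rbrakk> \<Longrightarrow> \<exists>y\<in>G0. x * y = 1"
    and char_zero: "n > 0 \<Longrightarrow> of_nat n \<noteq> (0 :: 'a)"
    and vector_zero: "0 \<in> G1"
    and vector_add: "\<lbrakk>u \<in> G1; v \<in> G1\<rbrakk> \<Longrightarrow> u + v \<in> G1"
    and vector_scale: "\<lbrakk>c \<in> G0; v \<in> G1\<rbrakk> \<Longrightarrow> c * v \<in> G1"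
    and scalar_vector_commute: "\<lbrakk>c \<in> G0; v \<in> G1\<rbrakk> \<Longrightarrow> c * v = v * c"
    and vector_square: "v \<in> G1 \<Longrightarrow> v * v \<in> G0"
    and nondegenerate: "\<lbrakk>v \<in> G1; \<And>u. u \<in> G1 \<Longrightarrow> orthogonal_vecs G0 u v\<rbrakk> \<Longrightarrow> v = 0"
    and direct_sum_grades: "\<exists>!f. grade_decomposition G0 G1 A f"

definition grade_part :: "'a::ring_1 set \<Rightarrow> 'a set \<Rightarrow> nat \<Rightarrow> 'a \<Rightarrow> 'a" where
  "grade_part G0 G1 r A = (THE f. grade_decomposition G0 G1 A f) r"

text \<open>The double sum runs over the finitely many nonzero components of \<open>A\<close> and \<open>B\<close>.\<close>

definition outer :: "'a::ring_1 set \<Rightarrow> 'a set \<Rightarrow> 'a \<Rightarrow> 'a \<Rightarrow> 'a" where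
  "outer G0 G1 A B =
    (\<Sum>r | grade_part G0 G1 r A \<noteq> 0. \<Sum>s | grade_part G0 G1 s B \<noteq> 0.
      grade_part G0 G1 (r + s) (grade_part G0 G1 r A * grade_part G0 G1 s B))"

text \<open>The subspace represented by a nonzero \<open>r\<close>-blade \<open>A\<close> with \<open>r \<ge> 1\<close>; the definition
  is meaningful only for such \<open>A\<close>.\<close>

definition blade_subspace :: "'a::ring_1 set \<Rightarrow> 'a set \<Rightarrow> 'a \<Rightarrow> 'a set" where
  "blade_subspace G0 G1 A = {a \<in> G1. outer G0 G1 a A = 0}"

definition is_direct_sum :: "'a::ring_1 set \<Rightarrow> 'a set \<Rightarrow> 'a set \<Rightarrow> bool" where
  "is_direct_sum W U V \<longleftrightarrow> U \<inter> V = {0} \<and> W = {u + v |u v. u \<in> U \<and> v \<in> V}"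

end

theory Submission
  imports Defs
begin

text \<open>Modulo products of fewer vectors, vectors anticommute, so a product of \<open>n\<close> vectors is
  alternating there. Orthogonalising the factors shows that the grade-\<open>n\<close> part of the
  product is a blade and vanishes iff the product is congruent to 0. By nondegeneracy, some vector
  \<open>u\<close> is orthogonal to all factors except a first one outside the span of the others, and the
  graded commutator with \<open>u\<close> strips that factor; hence the product is congruent to 0 iff the
  factors are linearly dependent. Both claims then reduce to linear algebra.\<close>

context geometric_algebra
begin

subsection \<open>Scalars and vectors\<close>

lemma scalar_diff: "x \<in> G0 \<Longrightarrow> y \<in> G0 \<Longrightarrow> x - y \<in> G0"
  using scalar_add[of x "- y"] scalar_uminus[of y] by simp

lemma scalar_prod_list_commute:
  assumes "c \<in> G0" "set vs \<subseteq> G1"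
  shows "c * prod_list vs = prod_list vs * c"
  using assms(2)
proof (induction vs)
  case (Cons v vs)
  have "c * (v * prod_list vs) = v * (c * prod_list vs)"
    using scalar_vector_commute[of c v] assms(1) Cons.prems by (simp flip: mult.assoc)
  then show ?case using Cons by (simp add: mult.assoc)
qed simp

lemma is_blade_cases:
  assumes "is_blade G0 G1 r A"
  obtains "r = 0" "A \<in> G0"
  | vs where "length vs = r" "set vs \<subseteq> G1" "sorted_wrt (orthogonal_vecs G0) vs" "A = prod_list vs"
  using assms unfolding is_blade_def by (auto split: if_splits)

text \<open>The axioms let scalars commute with scalars and vectors only. This passes to products of
  vectors, hence to blades and their sums, and the grade decomposition makes every element such a
  sum.\<close>

lemma scalar_central:
  assumes c: "c \<in> G0"
  shows "c * x = x * c"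
proof -
  have blade: "c * A = A * c" if "is_blade G0 G1 r A" for r A
    using that by (rule is_blade_cases) (use c scalar_commute scalar_prod_list_commute in auto)
  have mv: "c * A = A * c" if A: "A \<in> multivectors G0 G1 r" for r A
  proof -
    obtain As where As: "A = sum_list As" "\<forall>A\<in>set As. is_blade G0 G1 r A"
      using A unfolding multivectors_def by blast
    from As(2) have "c * sum_list As = sum_list As * c"
      by (induction As) (auto simp: distrib_left distrib_right blade)
    then show ?thesis using As by simp
  qed
  obtain f where "grade_decomposition G0 G1 x f"
    using direct_sum_grades[of x] by blast
  then show ?thesis
    unfolding grade_decomposition_def
    by (metis (no_types, lifting) mv sum.cong sum_distrib_left sum_distrib_right)
qed

lemma scalar_left_commute: "c \<in> G0 \<Longrightarrow> x * (c * y) = c * (x * y)"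
  using scalar_central[of c x] by (metis mult.assoc)

lemma half_scalar: "half G0 \<in> G0" and two_half: "2 * half G0 = 1"
proof -
  have two: "2 \<in> G0" "(2::'a) \<noteq> 0"
    using scalar_add[OF scalar_one scalar_one] char_zero[of 2] by auto
  then obtain h where h: "h \<in> G0" "2 * h = 1" using scalar_inverse by blast
  have "h' = h" if "h' \<in> G0" "2 * h' = 1" for h'
  proof -
    have "h * (2 * h') = h' * (2 * h)"
      using scalar_commute[OF h(1) that(1)] by (simp add: algebra_simps mult_2 mult_2_right)
    then show ?thesis using h that by simp
  qed
  then have "\<exists>!h. h \<in> G0 \<and> 2 * h = 1" using h by blast
  from theI'[OF this] have "half G0 \<in> G0 \<and> 2 * half G0 = 1"
    unfolding half_def .
  then show "half G0 \<in> G0" "2 * half G0 = 1" by auto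
qed

text \<open>Clears the factor \<open>half G0\<close>, so that later arguments can work with the
  anticommutator, which is twice the inner product.\<close>

lemma orthogonal_vecs_iff: "orthogonal_vecs G0 u v \<longleftrightarrow> u * v + v * u = 0"
proof
  assume "orthogonal_vecs G0 u v"
  then have "2 * (half G0 * (u * v + v * u)) = 0"
    by (simp add: orthogonal_vecs_def vec_inner_def)
  then show "u * v + v * u = 0" by (simp add: two_half flip: mult.assoc)
qed (simp add: orthogonal_vecs_def vec_inner_def)

text \<open>Polarisation of \<open>vector_square\<close>.\<close>

lemma anticommutator_scalar:
  assumes "u \<in> G1" "v \<in> G1"
  shows "u * v + v * u \<in> G0"
proof -
  have "u * v + v * u = (u + v) * (u + v) - u * u - v * v"
    by (simp add: algebra_simps)
  then show ?thesis
    using assms by (simp add: scalar_diff vector_square vector_add)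
qed

lemma anticommutator_linear:
  assumes "k \<in> G0"
  shows "u * (k * v + w) + (k * v + w) * u = k * (u * v + v * u) + (u * w + w * u)"
  using scalar_left_commute[OF assms, of u v] by (simp add: algebra_simps)

subsection \<open>Linear combinations\<close>

text \<open>The linear span over \<open>G0\<close>. Recursion on the list splits off one coefficient
  at a time, which matches the inductions on lists of factors below.\<close>

fun cspan :: "'a list \<Rightarrow> 'a set" where
  "cspan [] = {0}"
| "cspan (c # cs) = {k * c + x |k x. k \<in> G0 \<and> x \<in> cspan cs}"

lemma cspan_vectors: "set cs \<subseteq> G1 \<Longrightarrow> cspan cs \<subseteq> G1"
  by (induction cs) (auto simp: vector_zero intro!: vector_add vector_scale)

lemma cspan_ConsI: "k \<in> G0 \<Longrightarrow> x \<in> cspan cs \<Longrightarrow> k * c + x \<in> cspan (c # cs)"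
  by auto

lemma cspan_Cons_tail: "x \<in> cspan cs \<Longrightarrow> x \<in> cspan (c # cs)"
  using cspan_ConsI[OF scalar_zero, of x cs c] by simp

lemma cspan_zero: "0 \<in> cspan cs"
  by (induction cs) (simp, rule cspan_Cons_tail)

lemma cspan_add: "x \<in> cspan cs \<Longrightarrow> y \<in> cspan cs \<Longrightarrow> x + y \<in> cspan cs"
proof (induction cs arbitrary: x y)
  case (Cons c cs)
  then obtain k x' l y' where *: "k \<in> G0" "x' \<in> cspan cs" "l \<in> G0" "y' \<in> cspan cs"
    "x = k * c + x'" "y = l * c + y'" by auto
  then have "x + y = (k + l) * c + (x' + y')" by (simp add: algebra_simps)
  then show ?case using * Cons.IH scalar_add cspan_ConsI by metis
qed simp

lemma cspan_scale: "k \<in> G0 \<Longrightarrow> x \<in> cspan cs \<Longrightarrow> k * x \<in> cspan cs"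
proof (induction cs arbitrary: x)
  case (Cons c cs)
  then obtain l x' where *: "l \<in> G0" "x' \<in> cspan cs" "x = l * c + x'" by auto
  then have "k * x = (k * l) * c + k * x'" by (simp add: algebra_simps)
  then show ?case using * Cons scalar_mult cspan_ConsI by metis
qed simp

lemma cspan_diff: "x \<in> cspan cs \<Longrightarrow> y \<in> cspan cs \<Longrightarrow> x - y \<in> cspan cs"
  using cspan_add[of x cs "- 1 * y"] cspan_scale[OF scalar_uminus[OF scalar_one], of y cs] by simp

lemma cspan_append: "cspan (as @ bs) = {x + y |x y. x \<in> cspan as \<and> y \<in> cspan bs}"
proof (induction as)
  case (Cons a as)
  then show ?case by (auto simp: add.assoc) (metis add.assoc)+
qed simp

lemma cspan_superset: "set cs \<subseteq> cspan cs"
proof (induction cs)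
  case (Cons c cs)
  have "c \<in> cspan (c # cs)" using cspan_ConsI[OF scalar_one cspan_zero, of c] by simp
  moreover have "set cs \<subseteq> cspan (c # cs)" using Cons cspan_Cons_tail by blast
  ultimately show ?case by simp
qed simp

text \<open>Nondegeneracy makes the functionals \<open>u \<mapsto> u \<cdot> c\<close> separate the span of a finite list.\<close>

lemma in_cspan_if_orthogonal:
  assumes "set cs \<subseteq> G1" "c \<in> G1"
    and "\<And>u. u \<in> G1 \<Longrightarrow> \<forall>d\<in>set cs. orthogonal_vecs G0 u d \<Longrightarrow> orthogonal_vecs G0 u c"
  shows "c \<in> cspan cs"
  using assms
proof (induction cs arbitrary: c)
  case Nil
  then show ?case using nondegenerate by auto
next
  case (Cons d cs)
  have dG: "d \<in> G1" and csG: "set cs \<subseteq> G1" using Cons.prems by auto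
  show ?case
  proof (cases "\<forall>u\<in>G1. (\<forall>e\<in>set cs. orthogonal_vecs G0 u e) \<longrightarrow> orthogonal_vecs G0 u d")
    case True
    \<comment> \<open>Here orthogonality to \<open>d\<close> follows from orthogonality to
      \<open>cs\<close>, so the hypothesis on \<open>c\<close> already holds with \<open>cs\<close>
      alone.\<close>
    then have "c \<in> cspan cs"
      using Cons.prems by (intro Cons.IH csG) auto
    then show ?thesis by (rule cspan_Cons_tail)
  next
    case False
    then obtain w where w: "w \<in> G1" "\<forall>e\<in>set cs. orthogonal_vecs G0 w e"
      "\<not> orthogonal_vecs G0 w d" by auto
    define p where "p = (\<lambda>u v::'a. u * v + v * u)"
    have pG: "p u v \<in> G0" if "u \<in> G1" "v \<in> G1" for u v
      using that anticommutator_scalar by (simp add: p_def)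
    have o: "orthogonal_vecs G0 u v \<longleftrightarrow> p u v = 0" for u v
      by (simp add: orthogonal_vecs_iff p_def)
    have sym: "p u v = p v u" for u v by (simp add: p_def add.commute)
    have lin: "p u (k * v + x) = k * p u v + p u x" if "k \<in> G0" for u v x k
      using anticommutator_linear[OF that] by (simp add: p_def)
    obtain i where i: "i \<in> G0" "p w d * i = 1"
      using scalar_inverse[OF pG[OF w(1) dG]] w(3) o by auto
    \<comment> \<open>The multiple of \<open>d\<close> is chosen to make \<open>c'\<close>
      orthogonal to \<open>w\<close>.\<close>
    define c' where "c' = - (i * p w c) * d + c"
    have iG: "- (i * p w c) \<in> G0" using i pG w Cons.prems by (simp add: scalar_mult scalar_uminus)
    have c'G: "c' \<in> G1"
      unfolding c'_def by (intro vector_add vector_scale iG dG Cons.prems)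
    have "c' \<in> cspan cs"
    proof (rule Cons.IH[OF csG c'G])
      fix u assume u: "u \<in> G1" "\<forall>e\<in>set cs. orthogonal_vecs G0 u e"
      \<comment> \<open>\<open>u\<close> is corrected by a multiple of \<open>w\<close> so as to
        become orthogonal to \<open>d\<close> as well. The hypothesis on \<open>c\<close> then
        applies to \<open>u'\<close>, and \<open>p u' c = 0\<close> is the same equation as
        \<open>p u c' = 0\<close>.\<close>
      define k where "k = - (i * p u d)"
      have kG: "k \<in> G0" using i pG u dG by (simp add: k_def scalar_mult scalar_uminus)
      define u' where "u' = k * w + u"
      have u'G: "u' \<in> G1" using kG w u by (simp add: u'_def vector_add vector_scale)
      have e: "p u' x = k * p w x + p u x" for x
        using lin[OF kG, of x w u] sym unfolding u'_def by simp
      have "k * p w d = - p u d"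
        using i scalar_central[of i "p u d"] scalar_central[of i "p w d"]
        by (simp add: k_def mult.assoc)
      then have "\<forall>x\<in>set (d # cs). orthogonal_vecs G0 u' x"
        using u w by (auto simp: o e)
      then have "p u' c = 0" using Cons.prems(3)[OF u'G] o by simp
      then have *: "- (i * p u d) * p w c + p u c = 0" by (simp add: e k_def)
      have "p w c * p u d = p u d * p w c"
        using scalar_commute pG w u dG Cons.prems by simp
      then have "p u c' = 0"
        unfolding c'_def lin[OF iG] using * by (simp add: mult.assoc)
      then show "orthogonal_vecs G0 u c'" by (simp add: o)
    qed
    then have "(i * p w c) * d + c' \<in> cspan (d # cs)"
      using i pG w Cons.prems by (intro cspan_ConsI) (simp_all add: scalar_mult)
    then show ?thesis by (simp add: c'_def)
  qed
qed

subsection \<open>Products of fewer vectors\<close>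

text \<open>Only products of \<open>n - 2\<close>, \<open>n - 4\<close>, \dots vectors are admitted: with a fixed parity the
  graded commutator with a vector lowers the degree by one.\<close>

inductive_set lower :: "nat \<Rightarrow> 'a set" for n where
  lower_zero: "0 \<in> lower n"
| lower_step: "\<lbrakk>x \<in> lower n; k \<in> G0; set vs \<subseteq> G1; length vs + 2 * Suc j = n\<rbrakk>
    \<Longrightarrow> k * prod_list vs + x \<in> lower n"

lemma lower_add: "x \<in> lower n \<Longrightarrow> y \<in> lower n \<Longrightarrow> x + y \<in> lower n"
  by (induction rule: lower.induct) (auto simp: add.assoc intro: lower.intros)

lemma lower_scale:
  assumes "c \<in> G0"
  shows "x \<in> lower n \<Longrightarrow> c * x \<in> lower n"
proof (induction rule: lower.induct)
  case (lower_step x k vs j)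
  then have "(c * k) * prod_list vs + c * x \<in> lower n"
    using assms scalar_mult by (intro lower.lower_step) auto
  then show ?case by (simp add: algebra_simps)
qed (simp add: lower_zero)

lemma lower_uminus: "x \<in> lower n \<Longrightarrow> - x \<in> lower n"
  using lower_scale[OF scalar_uminus[OF scalar_one], of x n] by simp

lemma lower_diff: "x \<in> lower n \<Longrightarrow> y \<in> lower n \<Longrightarrow> x - y \<in> lower n"
  using lower_add[of x n "- y"] lower_uminus[of y n] by simp

lemma lower_generator:
  "\<lbrakk>k \<in> G0; set vs \<subseteq> G1; length vs + 2 * Suc j = n\<rbrakk> \<Longrightarrow> k * prod_list vs \<in> lower n"
  using lower_step[OF lower_zero, of k vs j n] by simp

lemma lower_empty: "lower 0 = {0}"
proof -
  have "x = 0" if "x \<in> lower 0" for x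
    using that by (cases rule: lower.cases) auto
  then show ?thesis using lower_zero by auto
qed

lemma lower_mono: "x \<in> lower n \<Longrightarrow> x \<in> lower (n + 2 * i)"
proof (induction rule: lower.induct)
  case (lower_step x k vs j)
  then show ?case by (intro lower.lower_step[where j = "j + i"]) auto
qed (rule lower_zero)

lemma lower_vector_left:
  assumes "a \<in> G1"
  shows "x \<in> lower n \<Longrightarrow> a * x \<in> lower (Suc n)"
proof (induction rule: lower.induct)
  case (lower_step x k vs j)
  have "k * prod_list (a # vs) + a * x \<in> lower (Suc n)"
    using assms lower_step by (intro lower.lower_step) auto
  then show ?case using scalar_left_commute[OF lower_step(2)] by (simp add: algebra_simps)
qed (simp add: lower_zero)

lemma lower_prod_left:
  "set vs \<subseteq> G1 \<Longrightarrow> x \<in> lower n \<Longrightarrow> prod_list vs * x \<in> lower (length vs + n)"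
  by (induction vs) (auto simp: mult.assoc intro: lower_vector_left)

text \<open>Passing \<open>a\<close> over one factor flips the sign up to an anticommutator. That is
  a scalar, so the error term is a product with two vectors fewer.\<close>

lemma swap_lower:
  assumes "a \<in> G1" "set xs \<subseteq> G1" "set ys \<subseteq> G1"
  shows "prod_list (a # xs @ ys) - (- 1) ^ length xs * prod_list (xs @ a # ys)
    \<in> lower (Suc (length xs + length ys))"
  using assms(2)
proof (induction xs)
  case (Cons x xs)
  let ?p = "prod_list (xs @ ys)" and ?q = "prod_list (xs @ a # ys)"
  have 1: "(a * x + x * a) * ?p \<in> lower (Suc (length (x # xs) + length ys))"
    using assms Cons.prems anticommutator_scalar[of a x]
    by (intro lower_generator[where j = 0]) auto
  have 2: "x * (prod_list (a # xs @ ys) - (- 1) ^ length xs * ?q)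
      \<in> lower (Suc (length (x # xs) + length ys))"
    using lower_vector_left[OF _ Cons.IH] Cons.prems by simp
  have "prod_list (a # (x # xs) @ ys) - (- 1) ^ length (x # xs) * prod_list ((x # xs) @ a # ys)
      = (a * x + x * a) * ?p - x * (prod_list (a # xs @ ys) - (- 1) ^ length xs * ?q)"
    by (cases "even (length xs)") (simp_all add: algebra_simps)
  then show ?case using lower_diff[OF 1 2] by simp
qed (simp add: lower_zero)

text \<open>By \<open>swap_lower\<close>, carrying \<open>u\<close> across a generator costs the
  sign of its length and an error in \<open>lower (Suc (length vs))\<close>, where
  \<open>Suc (length vs) + 2 * j = n\<close>. As all generators of \<open>lower (Suc n)\<close> have
  lengths of the parity of \<open>Suc n\<close>, one sign serves the whole sum.\<close>

lemma commutator_lower: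
  assumes u: "u \<in> G1"
  shows "x \<in> lower (Suc n) \<Longrightarrow> u * x - (- 1) ^ Suc n * (x * u) \<in> lower n"
proof (induction rule: lower.induct)
  case (lower_step x k vs j)
  have "u * prod_list vs - (- 1) ^ length vs * (prod_list vs * u) \<in> lower (Suc (length vs))"
    using swap_lower[OF u lower_step(3), of "[]"] by simp
  from lower_mono[OF this, of j]
  have "k * (u * prod_list vs - (- 1) ^ length vs * (prod_list vs * u)) \<in> lower n"
    using lower_step by (intro lower_scale) auto
  moreover have "(- 1) ^ length vs = (- 1 :: 'a) ^ Suc n"
    unfolding lower_step(4)[symmetric] by (simp add: power_add power_mult)
  ultimately have *: "k * (u * prod_list vs - (- 1) ^ Suc n * (prod_list vs * u)) \<in> lower n"
    by simp
  have "u * (k * prod_list vs + x) - (- 1) ^ Suc n * ((k * prod_list vs + x) * u)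
    = k * (u * prod_list vs - (- 1) ^ Suc n * (prod_list vs * u)) + (u * x - (- 1) ^ Suc n * (x * u))"
    using scalar_left_commute[OF lower_step(2), of u "prod_list vs"]
    by (cases "even (Suc n)") (simp_all add: algebra_simps)
  then show ?case using lower_add[OF * lower_step(5)] by simp
qed (simp add: lower_zero)

section \<open>Degeneracy as linear dependence\<close>

text \<open>Congruence of the product to 0. For lists of vectors this will be equivalent both to
  linear dependence and to the vanishing of the part of grade \<open>length vs\<close>.\<close>

definition degenerate :: "'a list \<Rightarrow> bool" where
  "degenerate vs \<longleftrightarrow> prod_list vs \<in> lower (length vs)"

lemma degenerate_Cons_tail: "c \<in> G1 \<Longrightarrow> degenerate cs \<Longrightarrow> degenerate (c # cs)"
  using lower_vector_left by (simp add: degenerate_def)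

text \<open>Write \<open>c = k * d + x\<close>. The first term produces the scalar
  \<open>d * d\<close>; in the second, swapping \<open>x\<close> and \<open>d\<close> leaves
  \<open>x\<close> in front of \<open>cs\<close>, where the induction hypothesis applies.\<close>

lemma degenerate_Cons_cspan:
  "set cs \<subseteq> G1 \<Longrightarrow> c \<in> cspan cs \<Longrightarrow> degenerate (c # cs)"
proof (induction cs arbitrary: c)
  case Nil
  then show ?case by (simp add: degenerate_def lower_zero)
next
  case (Cons d cs)
  then obtain k x where c: "c = k * d + x" "k \<in> G0" "x \<in> cspan cs" by auto
  have G: "d \<in> G1" "set cs \<subseteq> G1" "x \<in> G1" using Cons.prems c cspan_vectors by auto
  let ?p = "prod_list cs"
  have 1: "(k * (d * d)) * ?p \<in> lower (Suc (Suc (length cs)))"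
    using c G by (intro lower_generator[where j = 0]) (auto simp: scalar_mult vector_square)
  have 2: "(x * d + d * x) * ?p \<in> lower (Suc (Suc (length cs)))"
    using c G by (intro lower_generator[where j = 0]) (auto simp: anticommutator_scalar)
  have 3: "d * (x * ?p) \<in> lower (Suc (Suc (length cs)))"
    using lower_vector_left[OF G(1)] Cons.IH[OF G(2) c(3)] by (simp add: degenerate_def)
  have "prod_list (c # d # cs) = (k * (d * d)) * ?p + ((x * d + d * x) * ?p - d * (x * ?p))"
    by (simp add: c algebra_simps)
  then show ?case using lower_add[OF 1 lower_diff[OF 2 3]] by (simp add: degenerate_def)
qed

lemma orthogonal_commute_prod_list:
  assumes "\<forall>c\<in>set cs. orthogonal_vecs G0 u c"
  shows "prod_list cs * u = (- 1) ^ length cs * (u * prod_list cs)"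
  using assms
proof (induction cs)
  case (Cons c cs)
  have "c * u = - (u * c)" using Cons.prems by (simp add: orthogonal_vecs_iff add_eq_0_iff)
  then have "c * (u * y) = - (u * (c * y))" for y by (metis mult.assoc mult_minus_left)
  then show ?case using Cons
    by (cases "even (length cs)") (simp_all add: mult.assoc)
qed simp

text \<open>Iterated, this says that a list of vectors is degenerate iff some member lies in the
  span of the later ones.\<close>

lemma degenerate_Cons_iff:
  assumes "c \<in> G1" "set cs \<subseteq> G1"
  shows "degenerate (c # cs) \<longleftrightarrow> c \<in> cspan cs \<or> degenerate cs"
proof
  assume d: "degenerate (c # cs)"
  show "c \<in> cspan cs \<or> degenerate cs"
  proof (rule ccontr)
    assume n: "\<not> ?thesis"
    then obtain u where u: "u \<in> G1" "\<forall>d\<in>set cs. orthogonal_vecs G0 u d" "\<not> orthogonal_vecs G0 u c"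
      using in_cspan_if_orthogonal[of cs c] assms by blast
    let ?n = "length cs" and ?p = "prod_list cs"
    have "u * (c * ?p) - (- 1) ^ Suc ?n * ((c * ?p) * u) \<in> lower ?n"
      using commutator_lower[OF u(1)] d by (simp add: degenerate_def)
    \<comment> \<open>Moving \<open>u\<close> across \<open>?p\<close> gives the sign
      \<open>(- 1) ^ ?n\<close>, which cancels against the sign of the graded commutator. What
      remains of \<open>u\<close> and \<open>c\<close> is their anticommutator, a nonzero
      scalar.\<close>
    moreover have "u * (c * ?p) - (- 1) ^ Suc ?n * ((c * ?p) * u) = (u * c + c * u) * ?p"
      using orthogonal_commute_prod_list[OF u(2)]
      by (cases "even ?n") (simp_all add: algebra_simps)
    ultimately have l: "(u * c + c * u) * ?p \<in> lower ?n" by simp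
    obtain i where i: "i \<in> G0" "(u * c + c * u) * i = 1"
      using scalar_inverse[OF anticommutator_scalar[OF u(1) assms(1)]] u(3)
      by (auto simp: orthogonal_vecs_iff)
    have "i * (u * c + c * u) = 1" using i scalar_central[OF i(1)] by metis
    then have "?p \<in> lower ?n" using lower_scale[OF i(1) l] by (simp flip: mult.assoc)
    then show False using n by (simp add: degenerate_def)
  qed
qed (use assms degenerate_Cons_tail degenerate_Cons_cspan in auto)

text \<open>A shared vector either has coefficient 0 at \<open>a\<close>, which is the induction
  hypothesis, or can be solved for \<open>a\<close>. Conversely, writing \<open>a\<close> as a sum
  from the two spans exhibits the summand from \<open>cspan bs\<close> as a shared vector.\<close>

lemma degenerate_append_iff:
  assumes "set as \<subseteq> G1" "set bs \<subseteq> G1" "\<not> degenerate as" "\<not> degenerate bs"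
  shows "degenerate (as @ bs) \<longleftrightarrow> (\<exists>v. v \<noteq> 0 \<and> v \<in> cspan as \<and> v \<in> cspan bs)"
  using assms(1,3)
proof (induction as)
  case Nil
  then show ?case using assms by simp
next
  case (Cons a as)
  have G: "a \<in> G1" "set as \<subseteq> G1" using Cons.prems by auto
  have na: "a \<notin> cspan as" "\<not> degenerate as" using Cons.prems degenerate_Cons_iff[OF G] by auto
  note IH = Cons.IH[OF G(2) na(2)]
  have D: "degenerate ((a # as) @ bs) \<longleftrightarrow> a \<in> cspan (as @ bs) \<or> degenerate (as @ bs)"
    using degenerate_Cons_iff[of a "as @ bs"] G assms by simp
  show ?case
  proof
    assume "degenerate ((a # as) @ bs)"
    then consider "a \<in> cspan (as @ bs)" | "degenerate (as @ bs)" using D by blast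
    then show "\<exists>v. v \<noteq> 0 \<and> v \<in> cspan (a # as) \<and> v \<in> cspan bs"
    proof cases
      case 1
      then obtain x y where xy: "a = x + y" "x \<in> cspan as" "y \<in> cspan bs"
        by (auto simp: cspan_append)
      have "1 * a + (0 - x) \<in> cspan (a # as)"
        by (intro cspan_ConsI scalar_one cspan_diff[OF cspan_zero xy(2)])
      then have "y \<in> cspan (a # as)" using xy(1) by (simp add: algebra_simps)
      \<comment> \<open>\<open>y = 0\<close> would put \<open>a\<close> into
        \<open>cspan as\<close>.\<close>
      moreover have "y \<noteq> 0" using xy na by auto
      ultimately show ?thesis using xy by auto
    next
      case 2
      then obtain v where v: "v \<noteq> 0" "v \<in> cspan as" "v \<in> cspan bs" using IH by auto
      then show ?thesis using cspan_Cons_tail by blast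
    qed
  next
    assume "\<exists>v. v \<noteq> 0 \<and> v \<in> cspan (a # as) \<and> v \<in> cspan bs"
    then obtain v k x where v: "v \<noteq> 0" "v \<in> cspan bs" "v = k * a + x" "k \<in> G0" "x \<in> cspan as"
      by auto
    show "degenerate ((a # as) @ bs)"
    proof (cases "k = 0")
      case True
      then show ?thesis using v IH D by auto
    next
      case False
      then obtain i where i: "i \<in> G0" "k * i = 1" using scalar_inverse v by blast
      have "i * k = 1" using i v scalar_commute by metis
      then have "a = i * (0 - x) + i * v" using v(3)
        by (simp add: algebra_simps flip: mult.assoc)
      then have "a \<in> cspan (as @ bs)"
        unfolding cspan_append using i v cspan_scale cspan_diff[OF cspan_zero] by blast
      then show ?thesis using D by blast
    qed
  qed
qed

subsection \<open>Orthogonalisation\<close>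

text \<open>From an earlier occurrence of \<open>a\<close> on, the factors form a list whose head
  lies in the span of its tail; multiplying by the factors in front preserves the
  congruence.\<close>

lemma repeated_lower:
  assumes "set xs \<subseteq> G1" "set ys \<subseteq> G1" "a \<in> set xs"
  shows "prod_list (xs @ a # ys) \<in> lower (length xs + Suc (length ys))"
proof -
  obtain ps qs where xs: "xs = ps @ a # qs" using assms(3) by (auto dest: split_list)
  have "degenerate (a # qs @ a # ys)"
    using assms xs cspan_superset[of "qs @ a # ys"] by (intro degenerate_Cons_cspan) auto
  then have "prod_list ps * prod_list (a # qs @ a # ys) \<in> lower (length ps + length (a # qs @ a # ys))"
    using assms(1) xs unfolding degenerate_def by (intro lower_prod_left) auto
  then show ?thesis by (simp add: xs mult.assoc add.assoc)
qed

lemma orthogonal_sym: "orthogonal_vecs G0 u v \<longleftrightarrow> orthogonal_vecs G0 v u"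
  by (simp add: orthogonal_vecs_iff add.commute)

lemma orthogonal_combination:
  assumes "k \<in> G0" "orthogonal_vecs G0 u v" "orthogonal_vecs G0 u w"
  shows "orthogonal_vecs G0 u (k * v + w)"
  using assms anticommutator_linear[of k u v w] by (simp add: orthogonal_vecs_iff)

text \<open>As for determinants: expanding a modified factor gives the original one plus a product
  in which \<open>a\<close> is repeated. \<open>xs\<close> is general because the induction moves
  the head of \<open>ds\<close> into it.\<close>

lemma shear_lower:
  assumes "set xs \<subseteq> G1" "a \<in> set xs" "set ds \<subseteq> G1" "\<forall>d\<in>set ds. k d \<in> G0"
  shows "prod_list (xs @ ds) - prod_list (xs @ map (\<lambda>d. k d * a + d) ds)
    \<in> lower (length xs + length ds)"
  using assms
proof (induction ds arbitrary: xs)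
  case (Cons d ds)
  let ?m = "map (\<lambda>d. k d * a + d) ds"
  have G: "set ?m \<subseteq> G1" "k d \<in> G0"
    using Cons.prems by (auto intro!: vector_add vector_scale)
  have 1: "prod_list ((xs @ [d]) @ ds) - prod_list ((xs @ [d]) @ ?m)
      \<in> lower (length (xs @ [d]) + length ds)"
    using Cons.prems by (intro Cons.IH) auto
  have 2: "k d * prod_list (xs @ a # ?m) \<in> lower (length xs + Suc (length ?m))"
    using Cons.prems G by (intro lower_scale repeated_lower) auto
  have "prod_list xs * (k d * (a * prod_list ?m)) = k d * (prod_list xs * (a * prod_list ?m))"
    using scalar_left_commute[OF G(2)] .
  then have "prod_list (xs @ d # ds) - prod_list (xs @ map (\<lambda>d. k d * a + d) (d # ds))
    = (prod_list ((xs @ [d]) @ ds) - prod_list ((xs @ [d]) @ ?m)) - k d * prod_list (xs @ a # ?m)"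
    by (simp add: algebra_simps)
  moreover have "length xs + Suc (length ?m) = length (xs @ [d]) + length ds"
    "length xs + length (d # ds) = length (xs @ [d]) + length ds" by simp_all
  ultimately show ?case using lower_diff[OF 1] 2 by (simp only:)
qed (simp add: lower_zero)

text \<open>One Gram-Schmidt step. \<open>IH\<close> is the induction hypothesis of
  \<open>orthogonalise\<close>, taken as an assumption because that induction invokes this step
  twice, for a given non-null factor and for a sum of two null ones.\<close>

lemma orthogonalise_nonnull:
  assumes IH: "\<And>ds. \<lbrakk>length ds = n; set ds \<subseteq> G1\<rbrakk> \<Longrightarrow> \<exists>es. length es = n \<and> set es \<subseteq> G1
      \<and> sorted_wrt (orthogonal_vecs G0) es \<and> prod_list ds - prod_list es \<in> lower n
      \<and> (\<forall>w\<in>G1. (\<forall>d\<in>set ds. orthogonal_vecs G0 w d) \<longrightarrow> (\<forall>e\<in>set es. orthogonal_vecs G0 w e))"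
    and len: "length (xs @ ys) = n" and G: "a \<in> G1" "set xs \<subseteq> G1" "set ys \<subseteq> G1"
    and nonnull: "\<not> orthogonal_vecs G0 a a"
  shows "\<exists>es. length es = Suc n \<and> set es \<subseteq> G1
      \<and> sorted_wrt (orthogonal_vecs G0) es \<and> prod_list (xs @ a # ys) - prod_list es \<in> lower (Suc n)
      \<and> (\<forall>w\<in>G1. (\<forall>d\<in>set (xs @ a # ys). orthogonal_vecs G0 w d)
          \<longrightarrow> (\<forall>e\<in>set es. orthogonal_vecs G0 w e))"
proof -
  define ds where "ds = xs @ ys"
  have dG: "set ds \<subseteq> G1" and dl: "length ds = n" using G len by (auto simp: ds_def)
  obtain i where i: "i \<in> G0" "(a * a + a * a) * i = 1"
    using scalar_inverse[OF anticommutator_scalar[OF G(1) G(1)]] nonnull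
    by (auto simp: orthogonal_vecs_iff)
  \<comment> \<open>The Gram-Schmidt coefficient: \<open>k d * a + d\<close> is the projection of
    \<open>d\<close> to the orthogonal complement of \<open>a\<close>. The factors 2 in both
    anticommutators cancel.\<close>
  define k where "k = (\<lambda>d. - (i * (a * d + d * a)))"
  have kG: "\<forall>d\<in>set ds. k d \<in> G0"
    using i dG G anticommutator_scalar by (auto simp: k_def intro!: scalar_uminus scalar_mult)
  define ds' where "ds' = map (\<lambda>d. k d * a + d) ds"
  have d'G: "set ds' \<subseteq> G1" using kG dG G by (auto simp: ds'_def intro!: vector_add vector_scale)
  obtain es where es: "length es = n" "set es \<subseteq> G1" "sorted_wrt (orthogonal_vecs G0) es"
      "prod_list ds' - prod_list es \<in> lower n"
      "\<And>w. \<lbrakk>w \<in> G1; \<forall>d\<in>set ds'. orthogonal_vecs G0 w d\<rbrakk> \<Longrightarrow> \<forall>e\<in>set es. orthogonal_vecs G0 w e"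
    using IH[of ds'] d'G dl by (auto simp: ds'_def)
  have "orthogonal_vecs G0 a (k d * a + d)" if "d \<in> set ds" for d
  proof -
    have kd: "k d \<in> G0" using kG that by simp
    have "k d * (a * a + a * a) = - (a * d + d * a)"
      using i(2) scalar_central[OF i(1), of "a * d + d * a"] scalar_central[OF i(1), of "a * a + a * a"]
      by (simp add: k_def mult.assoc)
    then show ?thesis using anticommutator_linear[OF kd, of a a d] by (simp add: orthogonal_vecs_iff)
  qed
  then have oa: "\<forall>e\<in>set es. orthogonal_vecs G0 a e"
    using es(5)[OF G(1)] by (auto simp: ds'_def)
  \<comment> \<open>The sign of moving \<open>a\<close> to the front. It is absorbed into the first
    factor as \<open>c * a\<close>, so that the result is again a plain product of vectors.\<close>
  define c where "c = (- 1 :: 'a) ^ length xs"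
  have c: "c \<in> G0" "c * c = 1"
    using scalar_one scalar_uminus[OF scalar_one]
    by (cases "even (length xs)"; simp add: c_def)+
  have 1: "c * (prod_list (a # ds) - c * prod_list (xs @ a # ys)) \<in> lower (Suc n)"
    using lower_scale[OF c(1) swap_lower[OF G]] len by (simp add: ds_def c_def)
  have 2: "c * (prod_list (a # ds) - prod_list (a # ds')) \<in> lower (Suc n)"
    using lower_scale[OF c(1) shear_lower[of "[a]" a ds k]] G dG kG dl by (simp add: ds'_def)
  have 3: "c * (prod_list (a # ds') - prod_list (a # es)) \<in> lower (Suc n)"
    using lower_scale[OF c(1) lower_vector_left[OF G(1) es(4)]] by (simp add: right_diff_distrib)
  \<comment> \<open>The reordering, the shears and the induction hypothesis telescope, with
    \<open>c * c = 1\<close>.\<close>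
  have "prod_list (xs @ a # ys) - prod_list ((c * a) # es)
    = c * (prod_list (a # ds) - prod_list (a # ds')) + c * (prod_list (a # ds') - prod_list (a # es))
      - c * (prod_list (a # ds) - c * prod_list (xs @ a # ys))"
    using c(2) by (simp add: algebra_simps flip: mult.assoc)
  then have cong: "prod_list (xs @ a # ys) - prod_list ((c * a) # es) \<in> lower (Suc n)"
    using lower_diff[OF lower_add[OF 2 3] 1] by simp
  have scale: "orthogonal_vecs G0 w (c * a)" if "orthogonal_vecs G0 w a" for w
    using orthogonal_combination[OF c(1) that, of 0] by (simp add: orthogonal_vecs_iff)
  have "\<forall>e\<in>set es. orthogonal_vecs G0 (c * a) e"
    using oa scale orthogonal_sym by blast
  then have sorted: "sorted_wrt (orthogonal_vecs G0) ((c * a) # es)" using es(3) by simp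
  have perp: "\<forall>e\<in>set ((c * a) # es). orthogonal_vecs G0 w e"
    if "w \<in> G1" "\<forall>d\<in>set (xs @ a # ys). orthogonal_vecs G0 w d" for w
  proof -
    have "\<forall>d\<in>set ds'. orthogonal_vecs G0 w d"
      using that kG orthogonal_combination by (auto simp: ds'_def ds_def)
    then show ?thesis using es(5)[OF that(1)] that scale by auto
  qed
  have "set ((c * a) # es) \<subseteq> G1" "length ((c * a) # es) = Suc n"
    using es(1,2) vector_scale[OF c(1) G(1)] by simp_all
  then show ?thesis using sorted cong perp by blast
qed

text \<open>If all factors are null but two of them are not orthogonal, their sum is not null; so up to
  \<open>lower\<close> there is a non-null factor, which is moved to the front and then split off. The last
  conjunct keeps it orthogonal to the factors that the induction returns.\<close>

lemma orthogonalise: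
  "\<lbrakk>length as = n; set as \<subseteq> G1\<rbrakk> \<Longrightarrow> \<exists>es. length es = n \<and> set es \<subseteq> G1
      \<and> sorted_wrt (orthogonal_vecs G0) es \<and> prod_list as - prod_list es \<in> lower n
      \<and> (\<forall>w\<in>G1. (\<forall>d\<in>set as. orthogonal_vecs G0 w d) \<longrightarrow> (\<forall>e\<in>set es. orthogonal_vecs G0 w e))"
proof (induction n arbitrary: as)
  case 0
  then show ?case by (simp add: lower_zero)
next
  case (Suc n)
  consider "sorted_wrt (orthogonal_vecs G0) as"
    | a where "a \<in> set as" "\<not> orthogonal_vecs G0 a a"
    | "\<forall>a\<in>set as. orthogonal_vecs G0 a a" "\<not> sorted_wrt (orthogonal_vecs G0) as"
    by blast
  then show ?case
  proof cases
    case 1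
    then show ?thesis using Suc.prems lower_zero by (intro exI[of _ as]) auto
  next
    case 2
    then obtain xs ys where "as = xs @ a # ys" by (auto dest: split_list)
    then show ?thesis
      using orthogonalise_nonnull[OF Suc.IH, of xs ys a] Suc.prems 2 by auto
  next
    case 3
    then obtain i j where ij: "i < j" "j < length as" "\<not> orthogonal_vecs G0 (as ! i) (as ! j)"
      by (auto simp: sorted_wrt_iff_nth_less)
    define a b xs ys where "a = as ! i" "b = as ! j" "xs = take i as" "ys = drop (Suc i) as"
    note defs = this
    have as: "as = xs @ a # ys" using ij unfolding defs by (simp add: id_take_nth_drop)
    have "b = ys ! (j - Suc i)" "j - Suc i < length ys" using ij unfolding defs by auto
    then have b: "b \<in> set ys" by simp
    have G: "a \<in> G1" "b \<in> G1" "set xs \<subseteq> G1" "set ys \<subseteq> G1"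
      using as b Suc.prems by auto
    have null: "a * a + a * a = 0" "b * b + b * b = 0"
      using 3(1) as b unfolding orthogonal_vecs_iff by auto
    have ab: "a * b + b * a \<noteq> 0" using ij(3) by (simp add: defs orthogonal_vecs_iff)
    have "(a + b) * (a + b) + (a + b) * (a + b)
        = (a * a + a * a) + (b * b + b * b) + 2 * (a * b + b * a)"
      by (simp add: algebra_simps mult_2)
    moreover have "2 * (a * b + b * a) \<noteq> 0"
    proof
      assume "2 * (a * b + b * a) = 0"
      then have "half G0 * 2 * (a * b + b * a) = 0" by (simp add: mult.assoc)
      then show False using ab two_half scalar_central[OF half_scalar, of 2] by simp
    qed
    ultimately have nn: "\<not> orthogonal_vecs G0 (a + b) (a + b)"
      by (simp add: orthogonal_vecs_iff null)
    obtain es where es: "length es = Suc n" "set es \<subseteq> G1" "sorted_wrt (orthogonal_vecs G0) es"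
        "prod_list (xs @ (a + b) # ys) - prod_list es \<in> lower (Suc n)"
        "\<forall>w\<in>G1. (\<forall>d\<in>set (xs @ (a + b) # ys). orthogonal_vecs G0 w d)
          \<longrightarrow> (\<forall>e\<in>set es. orthogonal_vecs G0 w e)"
      using orthogonalise_nonnull[OF Suc.IH, of xs ys "a + b"] Suc.prems as G nn vector_add
      by auto
    \<comment> \<open>Replacing \<open>a\<close> by \<open>a + b\<close> changes the product by one
      in which \<open>b\<close> occurs twice, as \<open>b\<close> is also among
      \<open>ys\<close>.\<close>
    have "degenerate (b # ys)"
      using G b cspan_superset[of ys] by (intro degenerate_Cons_cspan) auto
    then have 1: "prod_list xs * (b * prod_list ys) \<in> lower (Suc n)"
      using lower_prod_left[OF G(3), of "b * prod_list ys" "Suc (length ys)"] Suc.prems as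
      by (simp add: degenerate_def)
    have "prod_list as - prod_list es
        = (prod_list (xs @ (a + b) # ys) - prod_list es) - prod_list xs * (b * prod_list ys)"
      by (simp add: as algebra_simps)
    then have cong: "prod_list as - prod_list es \<in> lower (Suc n)"
      using lower_diff[OF es(4) 1] by (simp only:)
    have "\<forall>d\<in>set (xs @ (a + b) # ys). orthogonal_vecs G0 w d"
      if "\<forall>d\<in>set as. orthogonal_vecs G0 w d" for w
      using that b orthogonal_combination[OF scalar_one, of w a b] by (auto simp: as)
    then show ?thesis using es(1-3,5) cong by blast
  qed
qed

subsection \<open>Grades\<close>

lemma multivectors_zero: "0 \<in> multivectors G0 G1 r"
  unfolding multivectors_def by (auto intro!: exI[of _ "[]"])

lemma multivectors_add:
  assumes "x \<in> multivectors G0 G1 r" "y \<in> multivectors G0 G1 r"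
  shows "x + y \<in> multivectors G0 G1 r"
proof -
  obtain As Bs where "x = sum_list As" "\<forall>A\<in>set As. is_blade G0 G1 r A"
      "y = sum_list Bs" "\<forall>A\<in>set Bs. is_blade G0 G1 r A"
    using assms unfolding multivectors_def by blast
  then show ?thesis unfolding multivectors_def by (auto intro!: exI[of _ "As @ Bs"])
qed

lemma blade_multivector: "is_blade G0 G1 r A \<Longrightarrow> A \<in> multivectors G0 G1 r"
  unfolding multivectors_def by (auto intro!: exI[of _ "[A]"])

lemma orthogonal_scale_left:
  assumes "c \<in> G0" "orthogonal_vecs G0 u v"
  shows "orthogonal_vecs G0 (c * u) v"
  using orthogonal_combination[OF assms(1), of v u 0] assms(2)
  by (simp add: orthogonal_vecs_iff add.commute)

lemma blade_scale:
  assumes "c \<in> G0" "is_blade G0 G1 r A"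
  shows "is_blade G0 G1 r (c * A)"
  using assms(2)
proof (cases rule: is_blade_cases)
  case 1
  then show ?thesis using assms(1) by (simp add: is_blade_def scalar_mult)
next
  case (2 vs)
  show ?thesis
  proof (cases vs)
    case Nil
    then show ?thesis using 2 assms scalar_one by (simp add: is_blade_def)
  next
    case (Cons v vs')
    then show ?thesis
      using 2 assms unfolding is_blade_def
      by (auto intro!: exI[of _ "(c * v) # vs'"] simp: mult.assoc vector_scale orthogonal_scale_left)
  qed
qed

lemma multivectors_scale:
  assumes "c \<in> G0" "x \<in> multivectors G0 G1 r"
  shows "c * x \<in> multivectors G0 G1 r"
proof -
  obtain As where As: "x = sum_list As" "\<forall>A\<in>set As. is_blade G0 G1 r A"
    using assms unfolding multivectors_def by blast
  have "c * sum_list As = sum_list (map ((*) c) As)" by (simp add: sum_list_const_mult)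
  then show ?thesis
    unfolding multivectors_def using As blade_scale[OF assms(1)]
    by (auto intro!: exI[of _ "map ((*) c) As"])
qed

lemma grade_decomposition_grade_part:
  "grade_decomposition G0 G1 x (\<lambda>r. grade_part G0 G1 r x)"
  using theI'[OF direct_sum_grades[of x]] by (simp add: grade_part_def)

lemma grade_part_eqI: "grade_decomposition G0 G1 x f \<Longrightarrow> grade_part G0 G1 r x = f r"
  using direct_sum_grades[of x] grade_decomposition_grade_part[of x] by metis

text \<open>Any finite superset of the support will do for the sum, so the exact support of a sum,
  where components may cancel, need not be computed.\<close>

lemma grade_decompositionI:
  assumes "\<And>r. f r \<in> multivectors G0 G1 r" "finite S" "{r. f r \<noteq> 0} \<subseteq> S" "x = sum f S"
  shows "grade_decomposition G0 G1 x f"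
proof -
  have "sum f S = (\<Sum>r | f r \<noteq> 0. f r)"
    using assms(2,3) by (intro sum.mono_neutral_right) auto
  then show ?thesis
    using assms(1,4) finite_subset[OF assms(3,2)] by (simp add: grade_decomposition_def)
qed

lemma grade_part_multivector: "grade_part G0 G1 r x \<in> multivectors G0 G1 r"
  using grade_decomposition_grade_part unfolding grade_decomposition_def by blast

lemma grade_part_add: "grade_part G0 G1 r (x + y) = grade_part G0 G1 r x + grade_part G0 G1 r y"
proof (rule grade_part_eqI)
  let ?f = "\<lambda>r. grade_part G0 G1 r x" and ?g = "\<lambda>r. grade_part G0 G1 r y"
  let ?S = "{r. ?f r \<noteq> 0} \<union> {r. ?g r \<noteq> 0}"
  have f: "finite {r. ?f r \<noteq> 0}" "x = sum ?f {r. ?f r \<noteq> 0}"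
    and g: "finite {r. ?g r \<noteq> 0}" "y = sum ?g {r. ?g r \<noteq> 0}"
    using grade_decomposition_grade_part unfolding grade_decomposition_def by blast+
  have "sum ?f ?S = sum ?f {r. ?f r \<noteq> 0}" "sum ?g ?S = sum ?g {r. ?g r \<noteq> 0}"
    using f(1) g(1) by (intro sum.mono_neutral_right; auto)+
  then have "x + y = (\<Sum>r\<in>?S. ?f r + ?g r)"
    using f(2) g(2) by (simp only: sum.distrib)
  then show "grade_decomposition G0 G1 (x + y) (\<lambda>r. ?f r + ?g r)"
    using f(1) g(1) by (intro grade_decompositionI[where S = ?S] multivectors_add grade_part_multivector)
      auto
qed

lemma grade_part_scale:
  assumes "c \<in> G0"
  shows "grade_part G0 G1 r (c * x) = c * grade_part G0 G1 r x"
proof (rule grade_part_eqI)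
  let ?f = "\<lambda>r. grade_part G0 G1 r x"
  have "finite {r. ?f r \<noteq> 0}" "x = sum ?f {r. ?f r \<noteq> 0}"
    using grade_decomposition_grade_part unfolding grade_decomposition_def by blast+
  then show "grade_decomposition G0 G1 (c * x) (\<lambda>r. c * ?f r)"
    by (intro grade_decompositionI[where S = "{r. ?f r \<noteq> 0}"] multivectors_scale assms
        grade_part_multivector) (auto simp flip: sum_distrib_left)
qed

lemma grade_part_of_multivector:
  assumes "x \<in> multivectors G0 G1 n"
  shows "grade_part G0 G1 r x = (if r = n then x else 0)"
  using assms multivectors_zero
  by (intro grade_part_eqI grade_decompositionI[where S = "{n}"]) auto

section \<open>The top-grade part of a product of vectors\<close>

lemma orthogonal_prod_list_multivector:
  assumes "set es \<subseteq> G1" "sorted_wrt (orthogonal_vecs G0) es"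
  shows "is_blade G0 G1 (length es) (prod_list es)"
  using assms scalar_one by (auto simp: is_blade_def)

text \<open>Its first assumption is the induction hypothesis of
  \<open>grade_part_prod_list_above\<close>, which needs the claim on \<open>lower n\<close> while
  products of \<open>n\<close> vectors are still being treated.\<close>

lemma grade_part_lower_aux:
  assumes "\<And>vs k. \<lbrakk>length vs < n; set vs \<subseteq> G1; length vs < k\<rbrakk> \<Longrightarrow> grade_part G0 G1 k (prod_list vs) = 0"
    and "x \<in> lower n" "n \<le> k"
  shows "grade_part G0 G1 k x = 0"
  using assms(2)
proof (induction rule: lower.induct)
  case lower_zero
  then show ?case using grade_part_of_multivector[OF multivectors_zero] by simp
next
  case (lower_step x c vs j)
  then have "grade_part G0 G1 k (prod_list vs) = 0" using assms(3) by (intro assms(1)) auto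
  then show ?case using lower_step by (simp add: grade_part_add grade_part_scale)
qed

text \<open>By \<open>orthogonalise\<close> the product is a blade of grade
  \<open>length vs\<close>, which has no part of grade \<open>k\<close>, plus a combination of
  shorter products.\<close>

lemma grade_part_prod_list_above:
  "set vs \<subseteq> G1 \<Longrightarrow> length vs < k \<Longrightarrow> grade_part G0 G1 k (prod_list vs) = 0"
proof (induction "length vs" arbitrary: vs k rule: less_induct)
  case less
  obtain es where es: "length es = length vs" "set es \<subseteq> G1" "sorted_wrt (orthogonal_vecs G0) es"
      "prod_list vs - prod_list es \<in> lower (length vs)"
    using orthogonalise[OF refl less.prems(1)] by blast
  have 1: "grade_part G0 G1 k (prod_list vs - prod_list es) = 0"
    by (rule grade_part_lower_aux[OF _ es(4)]) (use less in auto)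
  have 2: "grade_part G0 G1 k (prod_list es) = 0"
    using grade_part_of_multivector[OF blade_multivector[OF orthogonal_prod_list_multivector[OF es(2,3)]]]
      es less.prems by simp
  show ?case using grade_part_add[of k "prod_list vs - prod_list es" "prod_list es"] 1 2 by simp
qed

lemma grade_part_lower: "x \<in> lower n \<Longrightarrow> n \<le> k \<Longrightarrow> grade_part G0 G1 k x = 0"
  using grade_part_lower_aux grade_part_prod_list_above by blast

text \<open>All three come from one orthogonal list \<open>es\<close>: elements of
  \<open>lower (length vs)\<close> have no part of grade \<open>length vs\<close>, so
  \<open>prod_list es\<close> is that part of \<open>prod_list vs\<close>.\<close>

lemma
  assumes "set vs \<subseteq> G1"
  shows top_grade_part_blade: "is_blade G0 G1 (length vs) (grade_part G0 G1 (length vs) (prod_list vs))"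
    and top_grade_part_cong: "prod_list vs - grade_part G0 G1 (length vs) (prod_list vs) \<in> lower (length vs)"
    and top_grade_part_eq_0_iff: "grade_part G0 G1 (length vs) (prod_list vs) = 0 \<longleftrightarrow> degenerate vs"
proof -
  obtain es where es: "length es = length vs" "set es \<subseteq> G1" "sorted_wrt (orthogonal_vecs G0) es"
      "prod_list vs - prod_list es \<in> lower (length vs)"
    using orthogonalise[OF refl assms] by blast
  have b: "is_blade G0 G1 (length vs) (prod_list es)"
    using orthogonal_prod_list_multivector[OF es(2,3)] es(1) by simp
  have eq: "grade_part G0 G1 (length vs) (prod_list vs) = prod_list es"
    using grade_part_add[of "length vs" "prod_list vs - prod_list es" "prod_list es"]
      grade_part_lower[OF es(4)] grade_part_of_multivector[OF blade_multivector[OF b]] by simp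
  show "is_blade G0 G1 (length vs) (grade_part G0 G1 (length vs) (prod_list vs))"
    "prod_list vs - grade_part G0 G1 (length vs) (prod_list vs) \<in> lower (length vs)"
    using b es eq by auto
  show "grade_part G0 G1 (length vs) (prod_list vs) = 0 \<longleftrightarrow> degenerate vs"
    using grade_part_lower[of "prod_list vs" "length vs" "length vs"] es(4)
    unfolding eq degenerate_def by auto
qed

section \<open>Outer products and represented subspaces\<close>

lemma outer_multivectors:
  assumes "A \<in> multivectors G0 G1 r" "B \<in> multivectors G0 G1 s"
  shows "outer G0 G1 A B = grade_part G0 G1 (r + s) (A * B)"
proof -
  have 0: "grade_part G0 G1 k 0 = 0" for k
    using grade_part_of_multivector[OF multivectors_zero] by simp
  have A: "grade_part G0 G1 k A = (if k = r then A else 0)"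
    and B: "grade_part G0 G1 k B = (if k = s then B else 0)" for k
    using assms grade_part_of_multivector by auto
  \<comment> \<open>The double sum has at most one term; if \<open>A\<close> or \<open>B\<close> is
    0, it is empty and agrees with the grade part of 0.\<close>
  have "{k. (if k = n then x else 0) \<noteq> 0} = (if x = 0 then {} else {n})" for n :: nat and x :: 'a
    by auto
  then show ?thesis unfolding outer_def A B by (auto simp: 0)
qed

lemma vector_multivector: "a \<in> G1 \<Longrightarrow> a \<in> multivectors G0 G1 1"
  by (rule blade_multivector) (auto simp: is_blade_def intro!: exI[of _ "[a]"])

text \<open>\<open>a * ?A\<close> and \<open>a * prod_list vs\<close> differ by an element of
  \<open>lower (Suc ?n)\<close>, so \<open>outer G0 G1 a ?A\<close> vanishes iff
  \<open>a # vs\<close> is degenerate; as \<open>vs\<close> is not, this means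
  \<open>a \<in> cspan vs\<close>.\<close>

lemma blade_subspace_top_grade_part:
  assumes "set vs \<subseteq> G1" "\<not> degenerate vs"
  shows "blade_subspace G0 G1 (grade_part G0 G1 (length vs) (prod_list vs)) = cspan vs"
proof -
  let ?n = "length vs"
  let ?A = "grade_part G0 G1 ?n (prod_list vs)"
  have "outer G0 G1 a ?A = 0 \<longleftrightarrow> a \<in> cspan vs" if a: "a \<in> G1" for a
  proof -
    have "outer G0 G1 a ?A = grade_part G0 G1 (Suc ?n) (a * ?A)"
      using outer_multivectors[OF vector_multivector[OF a] grade_part_multivector] by simp
    also have "\<dots> = grade_part G0 G1 (Suc ?n) (a * (prod_list vs - ?A) + a * ?A)"
      using grade_part_lower[OF lower_vector_left[OF a top_grade_part_cong[OF assms(1)]]]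
      by (simp only: grade_part_add) simp
    also have "\<dots> = grade_part G0 G1 (length (a # vs)) (prod_list (a # vs))"
      by (simp add: algebra_simps)
    finally show ?thesis
      using top_grade_part_eq_0_iff[of "a # vs"] degenerate_Cons_iff[of a vs] a assms by simp
  qed
  then show ?thesis using cspan_vectors[OF assms(1)] by (auto simp: blade_subspace_def)
qed

text \<open>A blade is its own part of grade \<open>r\<close>, so \<open>A \<noteq> 0\<close> says
  that its factors are not degenerate.\<close>

lemma nonzero_blade_cases:
  assumes "is_blade G0 G1 r A" "r \<ge> 1" "A \<noteq> 0"
  obtains vs where "length vs = r" "set vs \<subseteq> G1" "A = prod_list vs" "\<not> degenerate vs"
    "blade_subspace G0 G1 A = cspan vs"
proof -
  obtain vs where vs: "length vs = r" "set vs \<subseteq> G1" "A = prod_list vs"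
    using assms by (auto elim: is_blade_cases)
  have eq: "grade_part G0 G1 (length vs) (prod_list vs) = A"
    using grade_part_of_multivector[OF blade_multivector[OF assms(1)]] vs by simp
  then have "\<not> degenerate vs" using top_grade_part_eq_0_iff[OF vs(2)] assms by simp
  then show thesis using that vs blade_subspace_top_grade_part[OF vs(2)] eq by simp
qed

end

theorem theorem15:
  fixes G0 G1 :: "'a::ring_1 set" and A B :: 'a and r s :: nat
  assumes "geometric_algebra G0 G1"
    and "r \<ge> 1" and "is_blade G0 G1 r A" and "A \<noteq> 0"
    and "s \<ge> 1" and "is_blade G0 G1 s B" and "B \<noteq> 0"
  shows "(outer G0 G1 A B = 0 \<longleftrightarrow>
            (\<exists>v. v \<noteq> 0 \<and> v \<in> blade_subspace G0 G1 A \<and> v \<in> blade_subspace G0 G1 B)) \<and>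
         (outer G0 G1 A B \<noteq> 0 \<longrightarrow>
            is_blade G0 G1 (r + s) (outer G0 G1 A B) \<and>
            is_direct_sum (blade_subspace G0 G1 (outer G0 G1 A B))
              (blade_subspace G0 G1 A) (blade_subspace G0 G1 B))"
proof -
  interpret geometric_algebra G0 G1 by (rule assms(1))
  obtain as where as: "length as = r" "set as \<subseteq> G1" "A = prod_list as" "\<not> degenerate as"
    "blade_subspace G0 G1 A = cspan as" using nonzero_blade_cases assms(2-4) by metis
  obtain bs where bs: "length bs = s" "set bs \<subseteq> G1" "B = prod_list bs" "\<not> degenerate bs"
    "blade_subspace G0 G1 B = cspan bs" using nonzero_blade_cases assms(5-7) by metis
  have G: "set (as @ bs) \<subseteq> G1" using as bs by simp
  \<comment> \<open>The factors of \<open>A\<close> need not be orthogonal to those of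
    \<open>B\<close>; this is why the results on top-grade parts are stated for arbitrary lists of
    vectors.\<close>
  have outer: "outer G0 G1 A B = grade_part G0 G1 (length (as @ bs)) (prod_list (as @ bs))"
    using outer_multivectors[OF assms(3,6)[THEN blade_multivector]] as bs by simp
  have zero: "outer G0 G1 A B = 0 \<longleftrightarrow> degenerate (as @ bs)"
    unfolding outer by (rule top_grade_part_eq_0_iff[OF G])
  have share: "degenerate (as @ bs) \<longleftrightarrow> (\<exists>v. v \<noteq> 0 \<and> v \<in> cspan as \<and> v \<in> cspan bs)"
    using degenerate_append_iff as bs by blast
  have "is_blade G0 G1 (r + s) (outer G0 G1 A B)"
    using top_grade_part_blade[OF G] as bs unfolding outer by simp
  moreover have "is_direct_sum (blade_subspace G0 G1 (outer G0 G1 A B)) (cspan as) (cspan bs)"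
    if "outer G0 G1 A B \<noteq> 0"
  proof -
    have "\<not> degenerate (as @ bs)" using that zero by simp
    then have "cspan as \<inter> cspan bs = {0}" using share cspan_zero by blast
    moreover have "blade_subspace G0 G1 (outer G0 G1 A B) = cspan (as @ bs)"
      unfolding outer using blade_subspace_top_grade_part[OF G] that zero by simp
    ultimately show ?thesis by (simp add: is_direct_sum_def cspan_append)
  qed
  ultimately show ?thesis using as(5) bs(5) zero share by simp
qed

end
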